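(* Consider symmetric noise rates $e:=e_0=e_1$, and define $$r_{\mathrm{opt}}:=\frac{r^*-2e}{1-2e}.$$ Under the assumption on $r^*$ and $f^*_{\mathcal D}$ stated in the context, learning with smooth rate $r=r_{\mathrm{opt}}$ under $(X,\widetilde Y)\sim\widetilde{\mathcal D}$, i.e. solving $\min_{f\in\mathcal F}\mathbb{E}_{(X,\widetilde Y)\sim\widetilde{\mathcal D}}[\ell(\mathbf f(X),\widetilde Y^{\mathrm{GLS},r_{\mathrm{opt}}})]$, yields $f^*_{\mathcal D}$, where: - when the noise rate satisfies $e<r^*/2$, $r=r_{\mathrm{opt}}>0$ (label smoothing); - when the noise rate satisfies $e=r^*/2$, $r=0$ (vanilla loss); - when the noise rate satisfies $e>r^*/2$, $r=r_{\mathrm{opt}}<0$ (negative label smoothing).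
   Context: Binary classification with label noise. $(X,Y)\sim\mathcal D$ with $X\in\mathcal X$ and clean label $Y\in\{0,1\}$. The noisy label $\widetilde Y\in\{0,1\}$ is conditionally independent of $X$ given $Y$, with $\mathbb P(\widetilde Y=1\mid Y=0)=e_0$ and $\mathbb P(\widetilde Y=0\mid Y=1)=e_1$; $\widetilde{\mathcal D}$ is the law of $(X,\widetilde Y)$. A model $f$ assigns to each $x$ a probability vector $\mathbf f(x)=(\mathbf f(x)_0,\mathbf f(x)_1)$ (a softmax output); $\mathcal F$ is the hypothesis space of models under consideration. The loss is cross-entropy, $\ell(\mathbf f(x),y)=-\log \mathbf f(x)_y$, extended linearly to vector labels: $\ell(\mathbf f(x),\mathbf v)=-\sum_{k\in\{0,1\}} v_k\log\mathbf f(x)_k$ for $\mathbf v\in\mathbb R^2$. Generalized label smoothing: for a label $y$ with one-hot vector $\mathbf y\in\mathbb R^2$ and smooth rate $r\in(-\infty,1]$, the smoothed label is $\mathbf y^{\mathrm{GLS},r}=(1-r)\mathbf y+\frac r2\mathbf 1$, where $\mathbf 1$ is the all-ones vector. $Y^{\mathrm{GLS},r}$ and $\widetilde Y^{\mathrm{GLS},r}$ denote the smoothed versions of $Y$ and $\widetilde Y$. Assumption on $r^*$ and $f^*_{\mathcal D}$: learning with the clean data distribution $\mathcal D$ with smooth rate $r^*\le 1$ makes the corresponding classifier $f^*_{\mathcal D}\in\arg\min_{f\in\mathcal F}\mathbb{E}_{(X,Y)\sim\mathcal D}[\ell(\mathbf f(X),Y^{\mathrm{GLS},r^*})]$ return the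 best performance on the unseen clean test data distribution.
   Formalization: The noise rate is assumed to satisfy e < 1/2: at e = 1/2 the rate r_opt is undefined, and for e > 1/2 one has e > r*/2 but r_opt ≥ 1, so the last sign claim fails; the noisy expected losses over the hypothesis space are assumed to exist. *)

theory Defs
  imports "HOL-Probability.Probability"
begin

(* Labels are elements of the two-element type 2 = {0, 1}, so that label vectors and
   model outputs live in real ^ 2 and are indexed by the labels themselves. *)

(* The rates are only prescribed for classes of positive probability: cond_prob is 0 when
   the conditioning event is null, which would otherwise force the rate of an absent class
   to be 0. For the same reason the independence condition is trivially true, as it should
   be, for an absent class. *)
locale noisy_labels = prob_space M
  for M :: "'w measure" and MX :: "'x measure"
    and X :: "'w \<Rightarrow> 'x" and Y Yn :: "'w \<Rightarrow> 2" and e0 e1 :: real +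
  assumes X_measurable: "X \<in> measurable M MX"
    and Y_measurable: "Y \<in> measurable M (count_space UNIV)"
    and Yn_measurable: "Yn \<in> measurable M (count_space UNIV)"
    and cond_indep: "\<And>A y z. A \<in> sets MX \<Longrightarrow>
      \<P>(\<omega> in M. X \<omega> \<in> A \<and> Yn \<omega> = z \<bar> Y \<omega> = y) =
      \<P>(\<omega> in M. X \<omega> \<in> A \<bar> Y \<omega> = y) * \<P>(\<omega> in M. Yn \<omega> = z \<bar> Y \<omega> = y)"
    and noise_rate_0: "\<P>(\<omega> in M. Y \<omega> = 0) > 0 \<Longrightarrow> \<P>(\<omega> in M. Yn \<omega> = 1 \<bar> Y \<omega> = 0) = e0"
    and noise_rate_1: "\<P>(\<omega> in M. Y \<omega> = 1) > 0 \<Longrightarrow> \<P>(\<omega> in M. Yn \<omega> = 0 \<bar> Y \<omega> = 1) = e1"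

definition joint_law ::
    "'w measure \<Rightarrow> 'x measure \<Rightarrow> ('w \<Rightarrow> 'x) \<Rightarrow> ('w \<Rightarrow> 2) \<Rightarrow> ('x \<times> 2) measure" where
  "joint_law M MX X Z = distr M (MX \<Otimes>\<^sub>M count_space UNIV) (\<lambda>\<omega>. (X \<omega>, Z \<omega>))"

(* Softmax outputs are probability vectors with strictly positive entries, so ln below
   is never applied to 0. *)
definition prob_model :: "'x measure \<Rightarrow> ('x \<Rightarrow> real ^ 2) \<Rightarrow> bool" where
  "prob_model MX f \<longleftrightarrow> f \<in> borel_measurable MX \<and>
     (\<forall>x\<in>space MX. (\<forall>k. 0 < f x $ k) \<and> (\<Sum>k\<in>UNIV. f x $ k) = 1)"

definition cross_entropy :: "real ^ 2 \<Rightarrow> real ^ 2 \<Rightarrow> real" where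
  "cross_entropy p v = - (\<Sum>k\<in>UNIV. v $ k * ln (p $ k))"

(* axis y 1 is the one-hot vector of y; the final 1 is the all-ones vector. *)
definition gls_label :: "real \<Rightarrow> 2 \<Rightarrow> real ^ 2" where
  "gls_label r y = (1 - r) *\<^sub>R axis y 1 + (r / 2) *\<^sub>R 1"

definition gls_loss :: "real \<Rightarrow> ('x \<Rightarrow> real ^ 2) \<Rightarrow> 'x \<times> 2 \<Rightarrow> real" where
  "gls_loss r f = (\<lambda>(x, y). cross_entropy (f x) (gls_label r y))"

(* Cross-entropy risks may be infinite and, for negative rates, the loss is unbounded in
   both directions, while the Bochner integral returns 0 on non-integrable functions.
   Expectations are therefore taken in the extended reals, as the difference of the
   integrals of the positive and negative parts; this is meaningful unless both are
   infinite. For integrable g it is the Bochner integral. *)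
definition has_expectation :: "'a measure \<Rightarrow> ('a \<Rightarrow> real) \<Rightarrow> bool" where
  "has_expectation P g \<longleftrightarrow> g \<in> borel_measurable P \<and>
     ((\<integral>\<^sup>+z. ennreal (g z) \<partial>P) < \<infinity> \<or> (\<integral>\<^sup>+z. ennreal (- g z) \<partial>P) < \<infinity>)"

definition ext_expectation :: "'a measure \<Rightarrow> ('a \<Rightarrow> real) \<Rightarrow> ereal" where
  "ext_expectation P g =
     enn2ereal (\<integral>\<^sup>+z. ennreal (g z) \<partial>P) - enn2ereal (\<integral>\<^sup>+z. ennreal (- g z) \<partial>P)"

definition gls_risk :: "('x \<times> 2) measure \<Rightarrow> real \<Rightarrow> ('x \<Rightarrow> real ^ 2) \<Rightarrow> ereal" where
  "gls_risk P r f = ext_expectation P (gls_loss r f)"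

(* The minimisation problem makes sense only if every risk being compared exists;
   otherwise it has no solutions. *)
definition gls_well_posed :: "('x \<times> 2) measure \<Rightarrow> ('x \<Rightarrow> real ^ 2) set \<Rightarrow> real \<Rightarrow> bool" where
  "gls_well_posed P F r \<longleftrightarrow> (\<forall>f\<in>F. has_expectation P (gls_loss r f))"

definition gls_argmin ::
    "('x \<times> 2) measure \<Rightarrow> ('x \<Rightarrow> real ^ 2) set \<Rightarrow> real \<Rightarrow> ('x \<Rightarrow> real ^ 2) set" where
  "gls_argmin P F r =
     {f. gls_well_posed P F r \<and> is_arg_min (gls_risk P r) (\<lambda>g. g \<in> F) f}"

(* fstar, learned at rate rstar, performs best among everything learned at an admissible
   rate. The argument perf is an arbitrary performance measure (larger is better): its
   value perf P g is the performance of g when tested on the distribution P. *)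
definition best_clean_rate ::
    "(('x \<times> 2) measure \<Rightarrow> ('x \<Rightarrow> real ^ 2) \<Rightarrow> real) \<Rightarrow> ('x \<times> 2) measure \<Rightarrow>
     ('x \<Rightarrow> real ^ 2) set \<Rightarrow> real \<Rightarrow> ('x \<Rightarrow> real ^ 2) \<Rightarrow> bool" where
  "best_clean_rate perf P F rstar fstar \<longleftrightarrow>
     rstar \<le> 1 \<and> fstar \<in> gls_argmin P F rstar \<and>
     (\<forall>r\<le>1. \<forall>g\<in>gls_argmin P F r. perf P g \<le> perf P fstar)"

definition r_opt :: "real \<Rightarrow> real \<Rightarrow> real" where
  "r_opt rstar e = (rstar - 2 * e) / (1 - 2 * e)"

end

theory Submission
  imports Defs
begin

text \<open>
  Given a clean pair \<open>(x, y)\<close>, the noisy label is \<open>y\<close> with probability \<open>1 - e\<close> and the other label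
  with probability \<open>e\<close>. Averaging the smoothed label at rate \<open>r\<close> over this noise gives the smoothed
  label of \<open>y\<close> at rate \<open>2 e + (1 - 2 e) r\<close>, which is \<open>rstar\<close> exactly when \<open>r = r_opt rstar e\<close>.
  Hence the two risks agree for every model whose noisy risk exists. In the extended reals this
  averaging has to be done separately on the positive and negative parts of the loss.
\<close>

text \<open>The bounds carry finiteness from \<open>c\<close> to \<open>a\<close> and from
  \<open>d\<close> to \<open>b\<close>. If exactly one of \<open>c\<close> and \<open>d\<close> is
  infinite, the balance equation forces the matching one of \<open>a\<close> and \<open>b\<close> to
  be infinite too, so both differences are the same infinity; otherwise all four are finite and the
  equation rearranges.\<close>

lemma ennreal_diff_eqI:
  fixes a b c d :: ennreal
  assumes "a + d = b + c" "a \<le> c" "b \<le> d" "c < \<infinity> \<or> d < \<infinity>"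
  shows "enn2ereal a - enn2ereal b = enn2ereal c - enn2ereal d"
proof -
  have "enn2ereal a + enn2ereal d = enn2ereal b + enn2ereal c"
    using assms(1) by (metis plus_ennreal.rep_eq)
  moreover have "enn2ereal a \<le> enn2ereal c" "enn2ereal b \<le> enn2ereal d"
    using assms(2,3) by (simp_all add: less_eq_ennreal.rep_eq)
  moreover have "enn2ereal c < \<infinity> \<or> enn2ereal d < \<infinity>"
    using assms(4) by (simp add: less_ennreal.rep_eq)
  moreover have "0 \<le> enn2ereal a" "0 \<le> enn2ereal b" "0 \<le> enn2ereal c" "0 \<le> enn2ereal d"
    by simp_all
  ultimately show ?thesis
    by (cases "enn2ereal a"; cases "enn2ereal b"; cases "enn2ereal c"; cases "enn2ereal d") auto
qed

text \<open>The functions \<open>u\<close> and \<open>v\<close> may overlap, so they need not be the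
  positive and negative parts of their difference; they only dominate these parts. Any such
  splitting gives the same value as long as one of its two integrals is finite.\<close>

lemma ext_expectation_diff:
  fixes u v :: "'a \<Rightarrow> real"
  assumes [measurable]: "u \<in> borel_measurable P" "v \<in> borel_measurable P"
    and nonneg: "\<And>z. z \<in> space P \<Longrightarrow> 0 \<le> u z" "\<And>z. z \<in> space P \<Longrightarrow> 0 \<le> v z"
    and fin: "(\<integral>\<^sup>+z. ennreal (u z) \<partial>P) < \<infinity> \<or> (\<integral>\<^sup>+z. ennreal (v z) \<partial>P) < \<infinity>"
  shows "ext_expectation P (\<lambda>z. u z - v z) =
    enn2ereal (\<integral>\<^sup>+z. ennreal (u z) \<partial>P) - enn2ereal (\<integral>\<^sup>+z. ennreal (v z) \<partial>P)"
  unfolding ext_expectation_def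
proof (rule ennreal_diff_eqI)
  \<comment> \<open>The identity is kept additive so that it can be integrated with no finiteness
    condition.\<close>
  have "ennreal (u z - v z) + ennreal (v z) = ennreal (- (u z - v z)) + ennreal (u z)"
    if "z \<in> space P" for z
    using nonneg[OF that]
    by (cases "v z \<le> u z") (simp_all add: ennreal_neg flip: ennreal_plus)
  then show "(\<integral>\<^sup>+z. ennreal (u z - v z) \<partial>P) + (\<integral>\<^sup>+z. ennreal (v z) \<partial>P) =
      (\<integral>\<^sup>+z. ennreal (- (u z - v z)) \<partial>P) + (\<integral>\<^sup>+z. ennreal (u z) \<partial>P)"
    by (simp flip: nn_integral_add cong: nn_integral_cong)
qed (use nonneg fin in \<open>auto intro!: nn_integral_mono ennreal_leI\<close>)

text \<open>Split the sample space by the values of both labels. Conditional independence says that,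
  inside the event \<open>Y = y\<close>, restricting further to \<open>Yn = z\<close> merely scales
  the law of \<open>X\<close> by \<open>q y z\<close>. The values of \<open>q\<close> on a class of
  probability zero are arbitrary and do not affect the integral.\<close>

lemma joint_law_cond_indep:
  assumes "noisy_labels M MX X Y Yn e0 e1"
    and q: "\<And>y z. \<P>(\<omega> in M. Y \<omega> = y) > 0 \<Longrightarrow> \<P>(\<omega> in M. Yn \<omega> = z \<bar> Y \<omega> = y) = q y z"
    and [measurable]: "g \<in> borel_measurable (MX \<Otimes>\<^sub>M count_space UNIV)"
  shows "(\<integral>\<^sup>+p. g p \<partial>joint_law M MX X Yn) =
    (\<integral>\<^sup>+p. (\<Sum>z\<in>UNIV. ennreal (q (snd p) z) * g (fst p, z)) \<partial>joint_law M MX X Y)"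
proof -
  interpret noisy_labels M MX X Y Yn e0 e1 by fact
  note [measurable] = X_measurable Y_measurable Yn_measurable
  let ?I = "\<lambda>y. indicator {\<omega>\<in>space M. Y \<omega> = y} :: _ \<Rightarrow> ennreal"
  let ?J = "\<lambda>y z. indicator {\<omega>\<in>space M. Y \<omega> = y \<and> Yn \<omega> = z} :: _ \<Rightarrow> ennreal"
  \<comment> \<open>Restriction to an event is expressed as a density by its indicator, so this
    compares unnormalised laws of \<open>X\<close>.\<close>
  have law: "distr (density M (?J y z)) MX X =
      density (distr (density M (?I y)) MX X) (\<lambda>_. ennreal (q y z))" for y z
  proof (rule measure_eqI)
    fix A assume "A \<in> sets (distr (density M (?J y z)) MX X)"
    then have A[measurable]: "A \<in> sets MX" by simp
    have l: "emeasure (distr (density M (?J y z)) MX X) A =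
        ennreal (\<P>(\<omega> in M. (X \<omega> \<in> A \<and> Yn \<omega> = z) \<and> Y \<omega> = y))"
      by (auto simp: emeasure_distr emeasure_density emeasure_eq_measure
          simp flip: indicator_inter_arith intro!: arg_cong[of _ _ "measure M"])
    have r: "emeasure (distr (density M (?I y)) MX X) A = ennreal (\<P>(\<omega> in M. X \<omega> \<in> A \<and> Y \<omega> = y))"
      by (auto simp: emeasure_distr emeasure_density emeasure_eq_measure
          simp flip: indicator_inter_arith intro!: arg_cong[of _ _ "measure M"])
    have "ennreal (\<P>(\<omega> in M. (X \<omega> \<in> A \<and> Yn \<omega> = z) \<and> Y \<omega> = y)) =
        ennreal (q y z) * ennreal (\<P>(\<omega> in M. X \<omega> \<in> A \<and> Y \<omega> = y))"
    proof (cases "\<P>(\<omega> in M. Y \<omega> = y) > 0")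
      case True
      have "0 \<le> q y z"
        using q[OF True, of z] by (metis cond_prob_def divide_nonneg_nonneg measure_nonneg)
      moreover have "\<P>(\<omega> in M. (X \<omega> \<in> A \<and> Yn \<omega> = z) \<and> Y \<omega> = y) =
          q y z * \<P>(\<omega> in M. X \<omega> \<in> A \<and> Y \<omega> = y)"
        using cond_indep[OF A, where y = y and z = z] q[OF True, of z] True
        by (simp add: cond_prob_def field_simps)
      ultimately show ?thesis by (simp add: ennreal_mult)
    next
      \<comment> \<open>For an absent class both sides vanish, whatever \<open>q y z\<close>
        is.\<close>
      case False
      moreover have "\<P>(\<omega> in M. S \<omega> \<and> Y \<omega> = y) \<le> \<P>(\<omega> in M. Y \<omega> = y)" for S
        by (rule finite_measure_mono) auto
      ultimately have "\<P>(\<omega> in M. S \<omega> \<and> Y \<omega> = y) = 0" for S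
        by (meson measure_le_0_iff not_less order_trans)
      then show ?thesis by (simp only: ennreal_0 mult_zero_right)
    qed
    then show "emeasure (distr (density M (?J y z)) MX X) A =
        emeasure (density (distr (density M (?I y)) MX X) (\<lambda>_. ennreal (q y z))) A"
      using A by (simp add: l r emeasure_density_const)
  qed simp
  have slice: "(\<integral>\<^sup>+\<omega>. ?J y z \<omega> * g (X \<omega>, z) \<partial>M) =
      (\<integral>\<^sup>+\<omega>. ?I y \<omega> * (ennreal (q y z) * g (X \<omega>, z)) \<partial>M)" for y z
  proof -
    have "(\<integral>\<^sup>+\<omega>. ?J y z \<omega> * g (X \<omega>, z) \<partial>M) = (\<integral>\<^sup>+x. g (x, z) \<partial>distr (density M (?J y z)) MX X)"
      by (simp add: nn_integral_distr nn_integral_density)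
    also have "\<dots> = (\<integral>\<^sup>+\<omega>. ?I y \<omega> * (ennreal (q y z) * g (X \<omega>, z)) \<partial>M)"
      unfolding law by (simp add: nn_integral_distr nn_integral_density)
    finally show ?thesis .
  qed
  have "(\<integral>\<^sup>+p. g p \<partial>joint_law M MX X Yn) = (\<integral>\<^sup>+\<omega>. g (X \<omega>, Yn \<omega>) \<partial>M)"
    unfolding joint_law_def by (simp add: nn_integral_distr)
  \<comment> \<open>At each sample point exactly one pair of label values contributes.\<close>
  also have "\<dots> = (\<integral>\<^sup>+\<omega>. (\<Sum>y\<in>UNIV. \<Sum>z\<in>UNIV. ?J y z \<omega> * g (X \<omega>, z)) \<partial>M)"
  proof (rule nn_integral_cong)
    fix \<omega> assume "\<omega> \<in> space M"
    then have "(\<Sum>z\<in>UNIV. ?J y z \<omega> * g (X \<omega>, z)) = (if y = Y \<omega> then g (X \<omega>, Yn \<omega>) else 0)" for y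
      by (auto simp: indicator_def if_distrib[of "\<lambda>x. x * _"] cong: if_cong)
    then show "g (X \<omega>, Yn \<omega>) = (\<Sum>y\<in>UNIV. \<Sum>z\<in>UNIV. ?J y z \<omega> * g (X \<omega>, z))" by simp
  qed
  also have "\<dots> = (\<Sum>y\<in>UNIV. \<Sum>z\<in>UNIV. \<integral>\<^sup>+\<omega>. ?J y z \<omega> * g (X \<omega>, z) \<partial>M)"
    by (subst nn_integral_sum, measurable, intro sum.cong refl, subst nn_integral_sum) measurable
  also have "\<dots> = (\<integral>\<^sup>+\<omega>. (\<Sum>y\<in>UNIV. \<Sum>z\<in>UNIV. ?I y \<omega> * (ennreal (q y z) * g (X \<omega>, z))) \<partial>M)"
    unfolding slice
    by (rule sym, subst nn_integral_sum, measurable, intro sum.cong refl, subst nn_integral_sum) measurable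
  also have "\<dots> = (\<integral>\<^sup>+\<omega>. (\<Sum>z\<in>UNIV. ennreal (q (Y \<omega>) z) * g (X \<omega>, z)) \<partial>M)"
  proof (rule nn_integral_cong)
    fix \<omega> assume "\<omega> \<in> space M"
    then have "(\<Sum>z\<in>UNIV. ?I y \<omega> * (ennreal (q y z) * g (X \<omega>, z))) =
        (if y = Y \<omega> then \<Sum>z\<in>UNIV. ennreal (q (Y \<omega>) z) * g (X \<omega>, z) else 0)" for y
      by (auto simp: indicator_def)
    then show "(\<Sum>y\<in>UNIV. \<Sum>z\<in>UNIV. ?I y \<omega> * (ennreal (q y z) * g (X \<omega>, z))) =
        (\<Sum>z\<in>UNIV. ennreal (q (Y \<omega>) z) * g (X \<omega>, z))" by simp
  qed
  also have "\<dots> = (\<integral>\<^sup>+p. (\<Sum>z\<in>UNIV. ennreal (q (snd p) z) * g (fst p, z)) \<partial>joint_law M MX X Y)"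
    unfolding joint_law_def by (subst nn_integral_distr) simp_all
  finally show ?thesis .
qed

text \<open>The previous lemma applies to the positive and negative parts of \<open>g\<close>
  separately. After averaging over \<open>z\<close> these may overlap, because \<open>g\<close> can
  change sign with the label, so \<open>ext_expectation_diff\<close> recombines them; the finiteness
  it requires is the existence of the noisy expectation.\<close>

lemma ext_expectation_joint_law_cond_indep:
  assumes nl: "noisy_labels M MX X Y Yn e0 e1"
    and q: "\<And>y z. \<P>(\<omega> in M. Y \<omega> = y) > 0 \<Longrightarrow> \<P>(\<omega> in M. Yn \<omega> = z \<bar> Y \<omega> = y) = q y z"
    and q_nonneg: "\<And>y z. 0 \<le> q y z"
    and g: "has_expectation (joint_law M MX X Yn) g"
  shows "ext_expectation (joint_law M MX X Yn) g =
    ext_expectation (joint_law M MX X Y) (\<lambda>(x, y). \<Sum>z\<in>UNIV. q y z * g (x, z))"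
proof -
  have sets: "sets (joint_law M MX X Z) = sets (MX \<Otimes>\<^sub>M count_space UNIV)" for Z
    by (simp add: joint_law_def)
  have [measurable]: "g \<in> borel_measurable (MX \<Otimes>\<^sub>M count_space UNIV)"
    using g by (simp add: has_expectation_def measurable_cong_sets[OF sets refl])
  \<comment> \<open>Averages the positive part of \<open>h\<close>; it is used for \<open>g\<close>
    and for its negation.\<close>
  define mix where "mix h = (\<lambda>p. \<Sum>z\<in>UNIV. q (snd p) z * max 0 (h (fst p, z)))"
    for h :: "'b \<times> 2 \<Rightarrow> real"
  have mix_nonneg: "0 \<le> mix h p" for h p
    unfolding mix_def by (intro sum_nonneg mult_nonneg_nonneg q_nonneg) simp
  have mix_measurable: "mix h \<in> borel_measurable (joint_law M MX X Y)"
    if [measurable]: "h \<in> borel_measurable (MX \<Otimes>\<^sub>M count_space UNIV)" for h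
    unfolding mix_def measurable_cong_sets[OF sets refl] by measurable
  have mix: "(\<integral>\<^sup>+p. ennreal (h p) \<partial>joint_law M MX X Yn) = (\<integral>\<^sup>+p. ennreal (mix h p) \<partial>joint_law M MX X Y)"
    if [measurable]: "h \<in> borel_measurable (MX \<Otimes>\<^sub>M count_space UNIV)" for h
  proof -
    have "ennreal (q y z) * ennreal (h (x, z)) = ennreal (q y z * max 0 (h (x, z)))" for x y z
      by (simp add: ennreal_mult q_nonneg max_def ennreal_neg)
    moreover have "(\<Sum>z\<in>UNIV. ennreal (q y z * max 0 (h (x, z)))) =
        ennreal (\<Sum>z\<in>UNIV. q y z * max 0 (h (x, z)))" for x y
      by (intro sum_ennreal mult_nonneg_nonneg q_nonneg) simp
    ultimately show ?thesis
      unfolding mix_def by (subst joint_law_cond_indep[OF nl q]) simp_all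
  qed
  have "(\<lambda>(x, y). \<Sum>z\<in>UNIV. q y z * g (x, z)) = (\<lambda>p. mix g p - mix (\<lambda>p. - g p) p)"
    by (auto simp: mix_def fun_eq_iff max_def algebra_simps simp flip: sum_subtractf
        intro!: sum.cong)
  moreover have "ext_expectation (joint_law M MX X Yn) g = enn2ereal (\<integral>\<^sup>+p. ennreal (mix g p) \<partial>joint_law M MX X Y)
      - enn2ereal (\<integral>\<^sup>+p. ennreal (mix (\<lambda>p. - g p) p) \<partial>joint_law M MX X Y)"
    by (simp add: ext_expectation_def mix)
  moreover have "\<dots> = ext_expectation (joint_law M MX X Y) (\<lambda>p. mix g p - mix (\<lambda>p. - g p) p)"
    using g by (intro ext_expectation_diff[symmetric] mix_measurable mix_nonneg)
      (simp_all add: has_expectation_def mix)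
  ultimately show ?thesis by simp
qed

lemma UNIV_2_eq: "(UNIV :: 2 set) = {0, 1}"
proof -
  \<comment> \<open>Arithmetic in the label type is modulo 2.\<close>
  have "(2::2) = 0" by simp
  then show ?thesis using UNIV_2 by auto
qed

lemma label_cases: "(y::2) = 0 \<or> y = 1"
  using UNIV_2_eq by auto

text \<open>The locale fixes only the flip probabilities. The probability of keeping the label is
  the complement, as the conditional probabilities of the two noisy labels sum to 1 for a class that
  occurs.\<close>

lemma symmetric_transition:
  assumes "noisy_labels M MX X Y Yn e e" and pos: "\<P>(\<omega> in M. Y \<omega> = y) > 0"
  shows "\<P>(\<omega> in M. Yn \<omega> = z \<bar> Y \<omega> = y) = (if z = y then 1 - e else e)"
proof -
  interpret noisy_labels M MX X Y Yn e e by fact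
  note [measurable] = X_measurable Y_measurable Yn_measurable
  have "\<P>(\<omega> in M. Y \<omega> = y) = \<P>(\<omega> in M. Yn \<omega> = 0 \<and> Y \<omega> = y) + \<P>(\<omega> in M. Yn \<omega> = 1 \<and> Y \<omega> = y)"
    by (subst finite_measure_Union[symmetric])
      (use label_cases in \<open>auto intro!: arg_cong[of _ _ "measure M"]\<close>)
  then have "\<P>(\<omega> in M. Yn \<omega> = 0 \<bar> Y \<omega> = y) + \<P>(\<omega> in M. Yn \<omega> = 1 \<bar> Y \<omega> = y) = 1"
    using pos by (simp add: cond_prob_def flip: add_divide_distrib)
  then show ?thesis
    using noise_rate_0 noise_rate_1 pos label_cases[of y] label_cases[of z] by auto
qed

text \<open>At least one class has positive probability, and for it \<open>e\<close> is a genuine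
  conditional probability. This makes \<open>e\<close> a valid nonnegative weight in the
  averaging.\<close>

lemma symmetric_rate_nonneg:
  assumes "noisy_labels M MX X Y Yn e e"
  shows "0 \<le> e"
proof -
  interpret noisy_labels M MX X Y Yn e e by fact
  note [measurable] = Y_measurable
  have "\<P>(\<omega> in M. Y \<omega> = 0) + \<P>(\<omega> in M. Y \<omega> = 1) = measure M (space M)"
    by (subst finite_measure_Union[symmetric])
      (use label_cases in \<open>auto intro!: arg_cong[of _ _ "measure M"]\<close>)
  then have "\<P>(\<omega> in M. Y \<omega> = 0) > 0 \<or> \<P>(\<omega> in M. Y \<omega> = 1) > 0"
    by (smt (verit) prob_space measure_nonneg)
  then show ?thesis
    using noise_rate_0 noise_rate_1 by (metis cond_prob_def divide_nonneg_nonneg measure_nonneg)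
qed

lemma gls_loss_average_noise:
  assumes "e \<noteq> 1 / 2"
  shows "(\<Sum>z\<in>UNIV. (if z = y then 1 - e else e) * gls_loss (r_opt r e) f (x, z)) = gls_loss r f (x, y)"
proof -
  define s where "s = r_opt r e"
  \<comment> \<open>Solving the definition of \<open>r_opt\<close> for the clean rate removes the
    division, leaving an identity that is linear in the logarithms of the model outputs.\<close>
  have r: "r = 2 * e + (1 - 2 * e) * s"
    using assms by (simp add: s_def r_opt_def field_simps)
  show ?thesis
    using label_cases[of y] unfolding s_def[symmetric] unfolding r
    by (auto simp: gls_loss_def cross_entropy_def gls_label_def UNIV_2_eq axis_def field_simps)
qed

theorem theorem3p3:
  fixes M :: "'w measure" and MX :: "'x measure"
    and X :: "'w \<Rightarrow> 'x" and Y Yn :: "'w \<Rightarrow> 2"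
    and e rstar :: real
    and F :: "('x \<Rightarrow> real ^ 2) set" and fstar :: "'x \<Rightarrow> real ^ 2"
    and perf :: "('x \<times> 2) measure \<Rightarrow> ('x \<Rightarrow> real ^ 2) \<Rightarrow> real"
  assumes "noisy_labels M MX X Y Yn e e"
    and "e < 1 / 2"
    and "\<And>f. f \<in> F \<Longrightarrow> prob_model MX f"
    and "best_clean_rate perf (joint_law M MX X Y) F rstar fstar"
    and "gls_well_posed (joint_law M MX X Yn) F (r_opt rstar e)"
  shows "fstar \<in> gls_argmin (joint_law M MX X Yn) F (r_opt rstar e)
    \<and> gls_argmin (joint_law M MX X Yn) F (r_opt rstar e) = gls_argmin (joint_law M MX X Y) F rstar
    \<and> (e < rstar / 2 \<longrightarrow> r_opt rstar e > 0)
    \<and> (e = rstar / 2 \<longrightarrow> r_opt rstar e = 0)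
    \<and> (e > rstar / 2 \<longrightarrow> r_opt rstar e < 0)"
proof -
  have fstar: "fstar \<in> gls_argmin (joint_law M MX X Y) F rstar"
    using assms(4) by (simp add: best_clean_rate_def)
  \<comment> \<open>Existence of the noisy risk is known only for members of \<open>F\<close>, which
    are the only models the minimisation compares.\<close>
  have risk: "gls_risk (joint_law M MX X Yn) (r_opt rstar e) f = gls_risk (joint_law M MX X Y) rstar f"
    if "f \<in> F" for f
  proof -
    have "has_expectation (joint_law M MX X Yn) (gls_loss (r_opt rstar e) f)"
      using assms(5) that by (simp add: gls_well_posed_def)
    then have "gls_risk (joint_law M MX X Yn) (r_opt rstar e) f =
        ext_expectation (joint_law M MX X Y)
          (\<lambda>(x, y). \<Sum>z\<in>UNIV. (if z = y then 1 - e else e) * gls_loss (r_opt rstar e) f (x, z))"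
      unfolding gls_risk_def
      using symmetric_rate_nonneg[OF assms(1)] assms(2)
      by (intro ext_expectation_joint_law_cond_indep[OF assms(1)] symmetric_transition[OF assms(1)])
        auto
    also have "\<dots> = gls_risk (joint_law M MX X Y) rstar f"
      using assms(2) by (simp add: gls_loss_average_noise gls_risk_def case_prod_unfold)
    finally show ?thesis .
  qed
  \<comment> \<open>Membership in \<open>gls_argmin\<close> includes well-posedness, so equality of
    the solution sets needs it on both sides: on the clean side it comes from \<open>fstar\<close>
    being a solution, on the noisy side it is assumed.\<close>
  have "gls_well_posed (joint_law M MX X Y) F rstar"
    using fstar by (simp add: gls_argmin_def)
  then have eq: "gls_argmin (joint_law M MX X Yn) F (r_opt rstar e) = gls_argmin (joint_law M MX X Y) F rstar"
    using assms(5) risk by (auto simp: gls_argmin_def is_arg_min_def)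
  \<comment> \<open>Since \<open>e < 1 / 2\<close>, the denominator of \<open>r_opt\<close> is
    positive and the sign is that of \<open>rstar - 2 * e\<close>.\<close>
  moreover have "(e < rstar / 2 \<longrightarrow> r_opt rstar e > 0) \<and> (e = rstar / 2 \<longrightarrow> r_opt rstar e = 0)
      \<and> (e > rstar / 2 \<longrightarrow> r_opt rstar e < 0)"
    using assms(2) by (auto simp: r_opt_def intro: divide_neg_pos)
  ultimately show ?thesis using fstar by simp
qed

end
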